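(* Let $n,k\ge 0$ be integers. Then $B_{n,k}(x)=\sum_{d\ge 0}\gamma_k((k+1)d)\,x^{d}$, where the coefficients $\gamma_k(j)$ (which depend on $n$) are defined by $$\sum_j\gamma_k(j)u^j=Q_k(u)\left(\frac{1-u^{k+1}}{1-u}\right)^{n-k},$$ with $$Q_k(u)=\sum_{j=0}^{k}B_{k-j}(u^{k+1})(u^{k+1}-1)^j\sum_{i=j}^{k}\binom{i}{j}u^{-i}.$$
   Context: For integers $a,b$ write $[a,b]=\{a,a+1,\dots,b\}$ (empty if $a>b$) and $[n]=[1,n]$. $B_n$ denotes the group of signed permutations: bijections $\pi$ of $[-n,n]$ with $\pi(-i)=-\pi(i)$ (so $\pi(0)=0$), written in one-line notation $\pi=\pi(1),\dots,\pi(n)$; $B_0$ consists of the single empty signed permutation. The type B descent number is $\mathrm{des}_B(\pi)=|\{i\in[0,n-1]:\pi(i)>\pi(i+1)\}|$, with $\pi(0)=0$. The type B maximum drop of $\pi\in B_n$ is $$\mathrm{maxdrop}_B(\pi)=\max\Big\{\max\{i-\pi(i): i\in[n],\ \pi(i)>0\},\ \max\{i: i\in[n],\ \pi(i)<0\}\Big\},$$ where an empty inner maximum is disregarded, and the value is $0$ for $n=0$. Define $\mathcal{B}_{n,k}=\{\pi\in B_n:\mathrm{maxdrop}_B(\pi)\le k\}$, $B_{n,k}(x)=\sum_{\pi\in\mathcal{B}_{n,k}}x^{\mathrm{des}_B(\pi)}$, and the type B Eulerian polynomial $B_n(x)=\sum_{\pi\in B_n}x^{\mathrm{des}_B(\pi)}$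 (so $B_0(x)=1$). The expression defining $\gamma_k(j)$ is read as a formal Laurent series in $u$ (powers of $\frac{1-u^{k+1}}{1-u}=1+u+\cdots+u^k$ with negative exponent are expanded as formal power series in $u$). *)

theory Defs
  imports
    "HOL-Combinatorics.Permutations"
    "HOL-Computational_Algebra.Polynomial_FPS"
    "HOL-Computational_Algebra.Formal_Laurent_Series"
begin

(* permutes fixes all integers outside [-n,n], so every bijection of [-n,n] is represented by
   exactly one function on int; for n = 0 the only element is the identity. *)
definition signed_perms :: "nat \<Rightarrow> (int \<Rightarrow> int) set" where
  "signed_perms n = {\<pi>. \<pi> permutes {- int n..int n} \<and> (\<forall>i\<in>{- int n..int n}. \<pi> (- i) = - \<pi> i)}"

definition des_B :: "nat \<Rightarrow> (int \<Rightarrow> int) \<Rightarrow> nat" where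
  "des_B n \<pi> = card {i \<in> {0..int n - 1}. \<pi> i > \<pi> (i + 1)}"

(* Removing {} from the two index families is the convention that an empty inner maximum
   is disregarded. For n > 0 at least one of them is nonempty. *)
definition maxdrop_B :: "nat \<Rightarrow> (int \<Rightarrow> int) \<Rightarrow> int" where
  "maxdrop_B n \<pi> =
     (if n = 0 then 0
      else Max (Max ` ({{i - \<pi> i |i. i \<in> {1..int n} \<and> \<pi> i > 0},
                        {i. i \<in> {1..int n} \<and> \<pi> i < 0}} - {{}})))"

definition maxdrop_perms :: "nat \<Rightarrow> nat \<Rightarrow> (int \<Rightarrow> int) set" where
  "maxdrop_perms n k = {\<pi> \<in> signed_perms n. maxdrop_B n \<pi> \<le> int k}"

definition maxdrop_poly :: "nat \<Rightarrow> nat \<Rightarrow> int poly" where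
  "maxdrop_poly n k = (\<Sum>\<pi>\<in>maxdrop_perms n k. monom 1 (des_B n \<pi>))"

definition eulerian_B :: "nat \<Rightarrow> int poly" where
  "eulerian_B n = (\<Sum>\<pi>\<in>signed_perms n. monom 1 (des_B n \<pi>))"

(* Laurent series are taken over the rationals, so that they form a field and negative powers of
   1 + u + ... + u^k are available; the inverse is the expansion at u = 0. Integer polynomials are
   evaluated at a Laurent series after mapping their coefficients by of_int. *)
definition Q_series :: "nat \<Rightarrow> rat fls" where
  "Q_series k =
     (\<Sum>j=0..k. poly (map_poly of_int (eulerian_B (k - j))) (fls_X ^ (k + 1))
        * (fls_X ^ (k + 1) - 1) ^ j
        * (\<Sum>i=j..k. of_nat (i choose j) * fls_X powi (- int i)))"

definition gamma_coeff :: "nat \<Rightarrow> nat \<Rightarrow> int \<Rightarrow> rat" where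
  "gamma_coeff n k j =
     fls_nth (Q_series k * ((1 - fls_X ^ (k + 1)) / (1 - fls_X)) powi (int n - int k)) j"

end

theory Submission imports Defs begin

text \<open>
  Write \<open>x = u^(k+1)\<close>. In a signed permutation of \<open>[n]\<close> with \<open>n > k\<close> and maximum drop at most
  \<open>k\<close>, the last entry is at least \<open>n - k > 0\<close>. Hence a decreasing block of \<open>i\<close> final entries is
  an arbitrary \<open>i\<close>-subset of \<open>{n-k..n}\<close>, and removing it and standardizing yields
  \<open>B\<^bsub>n,k\<^esub>(x) = (\<Sum>i=1..k+1. (k+1 choose i) (x-1)^(i-1) B\<^bsub>n-i,k\<^esub>(x))\<close>.
  The series \<open>Q\<^sub>k(u) w^(n-k)\<close> with \<open>w = (1-x)/(1-u)\<close> satisfy the same recurrence, because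
  \<open>(1 + (x-1)/w)^(k+1) = u^(k+1) = x\<close>, and extracting the exponents divisible by \<open>k+1\<close> is linear
  over polynomials in \<open>x\<close>. For \<open>n \<le> k\<close> the extraction from \<open>Q\<^sub>k(u) (1-u)^(k-n)\<close> gives
  \<open>(1-x)^(k-n) B\<^sub>n(x)\<close> by binomial inversion, and \<open>B\<^bsub>n,k\<^esub> = B\<^sub>n\<close>.
\<close>

subsection \<open>Signed words with bounded drop\<close>

text \<open>A signed permutation is encoded as the list \<open>\<pi>(n), \<dots>, \<pi>(1)\<close>: read backwards, the position of
  an entry is the length of the suffix starting at it, and a descent is an ascent of the list
  (with \<open>\<pi>(0) = 0\<close> appended).\<close>

fun rdes :: "int list \<Rightarrow> nat" where
  "rdes [] = 0"
| "rdes (a # r) = (if a < (case r of [] \<Rightarrow> 0 | b # _ \<Rightarrow> b) then 1 else 0) + rdes r"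

fun drop_bounded :: "nat \<Rightarrow> int list \<Rightarrow> bool" where
  "drop_bounded k [] \<longleftrightarrow> True"
| "drop_bounded k (a # r) \<longleftrightarrow>
     (0 < a \<longrightarrow> 1 + int (length r) - a \<le> int k) \<and> (a < 0 \<longrightarrow> length r < k) \<and> drop_bounded k r"

text \<open>\<open>V\<close> is arbitrary because deleting a block of entries leaves gaps in the set
  of absolute values.\<close>

definition words :: "nat \<Rightarrow> int set \<Rightarrow> int list set" where
  "words k V = {r. distinct (map abs r) \<and> abs ` set r = V \<and> drop_bounded k r}"

text \<open>The variable lives in any commutative ring, so that the recurrence can be used directly
  at the Laurent series \<open>fls_X ^ (k + 1)\<close>.\<close>

definition words_poly :: "nat \<Rightarrow> int set \<Rightarrow> 'a \<Rightarrow> 'a :: comm_ring_1" where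
  "words_poly k V x = (\<Sum>r\<in>words k V. x ^ rdes r)"

lemma length_words:
  assumes "r \<in> words k V"
  shows "length r = card V"
  using assms distinct_card[of "map abs r"] by (auto simp: words_def)

lemma finite_words:
  assumes "finite V"
  shows "finite (words k V)"
proof (rule finite_subset)
  show "words k V \<subseteq> {r. set r \<subseteq> V \<union> uminus ` V \<and> length r = card V}"
  proof safe
    fix r a assume r: "r \<in> words k V" and a: "a \<in> set r" "a \<notin> uminus ` V"
    have "\<bar>a\<bar> \<in> V" using r a by (auto simp: words_def)
    with a(2) show "a \<in> V" by (cases "a < 0") (auto simp: image_iff)
  qed (simp add: length_words)
  show "finite {r. set r \<subseteq> V \<union> uminus ` V \<and> length r = card V}"
    using assms by (intro finite_lists_length_eq) auto
qed

text \<open>This telescoping sum over the lengths of the ascending prefixes stands in for the usual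
  inclusion-exclusion over marked descents. For \<open>r = [-1]\<close> the sum is \<open>1\<close> instead of \<open>x\<close>, so
  positivity of the head is needed.\<close>
lemma power_rdes_expand:
  fixes x :: "'a :: comm_ring_1"
  assumes "r \<noteq> []" "0 < hd r"
  shows "x ^ rdes r = (\<Sum>i<length r. if sorted_wrt (<) (take (Suc i) r)
           then (x - 1) ^ i * x ^ rdes (drop (Suc i) r) else 0)"
  using assms
proof (induction r)
  case (Cons a r)
  show ?case
  proof (cases r)
    case Nil
    with Cons.prems show ?thesis by simp
  next
    case (Cons b s)
    let ?g = "\<lambda>i. if sorted_wrt (<) (take (Suc i) r)
       then (x - 1) ^ i * x ^ rdes (drop (Suc i) r) else 0"
    let ?f = "\<lambda>i. if sorted_wrt (<) (take (Suc i) (a # r))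
       then (x - 1) ^ i * x ^ rdes (drop (Suc i) (a # r)) else 0"
    have f_Suc: "?f (Suc i) = (if a < b \<and> sorted_wrt (<) (take (Suc i) r)
        then (x - 1) ^ Suc i * x ^ rdes (drop (Suc i) r) else 0)" for i
    proof -
      have "sorted_wrt (<) (take (Suc (Suc i)) (a # r)) \<longleftrightarrow>
          a < b \<and> sorted_wrt (<) (take (Suc i) r)"
        using Cons by auto
      thus ?thesis by (simp only: drop_Suc_Cons)
    qed
    have "(\<Sum>i<length (a # r). ?f i) = ?f 0 + (\<Sum>i<length r. ?f (Suc i))"
      unfolding list.size add_0_right add_Suc_right by (rule sum.lessThan_Suc_shift)
    also have "?f 0 = x ^ rdes r" by simp
    also have "(\<Sum>i<length r. ?f (Suc i)) =
      (\<Sum>i<length r. if a < b \<and> sorted_wrt (<) (take (Suc i) r)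
         then (x - 1) ^ Suc i * x ^ rdes (drop (Suc i) r) else 0)"
      by (simp only: f_Suc)
    also have "(\<Sum>i<length r. if a < b \<and> sorted_wrt (<) (take (Suc i) r)
         then (x - 1) ^ Suc i * x ^ rdes (drop (Suc i) r) else 0)
       = (if a < b then (x - 1) * (\<Sum>i<length r. ?g i) else 0)"
      by (auto simp: sum_distrib_left intro!: sum.cong)
    \<comment> \<open>If \<open>a < b\<close>, the head \<open>b\<close> of \<open>r\<close> is
      positive too, so the induction hypothesis applies. Adding the term \<open>x ^ rdes r\<close>
      for \<open>i = 0\<close> then yields one more factor \<open>x\<close>.\<close>
    also have "\<dots> = (if a < b then (x - 1) * x ^ rdes r else 0)"
      using Cons.IH Cons Cons.prems by auto
    finally show ?thesis using Cons by (simp add: algebra_simps)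
  qed
qed simp

section \<open>Splitting off an ascending prefix\<close>

lemma drop_bounded_append:
  assumes "\<forall>a\<in>set xs. 0 < a \<and> int (length (xs @ s)) - a \<le> int k"
  shows "drop_bounded k (xs @ s) \<longleftrightarrow> drop_bounded k s"
  \<comment> \<open>The head has the largest position, so the bound taken there covers every entry
    of \<open>xs\<close>.\<close>
  using assms by (induction xs) force+

lemma drop_bounded_appendD: "drop_bounded k (xs @ s) \<Longrightarrow> drop_bounded k s"
  by (induction xs) auto

text \<open>The head stands at position n > k, so it must be positive and at least n - k, and the
  later entries of an ascending prefix are larger. Conversely, an entry from {n-k..n} drops by at
  most k at any position up to n. So the prefix amounts to its set \<open>C\<close> and restricts
  the rest only through the letters left over.\<close>

lemma sum_words_sorted_prefix:
  fixes g :: "int list \<Rightarrow> 'a :: comm_ring_1"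
  assumes "k < n" "0 < i" "i \<le> n"
  shows "(\<Sum>r\<in>{r \<in> words k {1..int n}. sorted_wrt (<) (take i r)}. g (drop i r))
       = (\<Sum>C | C \<subseteq> {int n - int k..int n} \<and> card C = i. \<Sum>s\<in>words k ({1..int n} - C). g s)"
    (is "?L = ?R")
proof -
  let ?Cs = "{C. C \<subseteq> {int n - int k..int n} \<and> card C = i}"
  have fin: "finite C" if "C \<in> ?Cs" for C
    using that finite_subset by blast
  have "?R = (\<Sum>(C, s)\<in>Sigma ?Cs (\<lambda>C. words k ({1..int n} - C)). g s)"
    by (intro sum.Sigma) (auto intro: finite_words)
  also have "\<dots> = ?L"
  proof (rule sum.reindex_bij_witness[where
      i = "\<lambda>r. (set (take i r), drop i r)" and j = "\<lambda>(C, s). sorted_list_of_set C @ s"])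
    fix p assume p: "p \<in> Sigma ?Cs (\<lambda>C. words k ({1..int n} - C))"
    obtain C s where ps: "p = (C, s)" by force
    have C: "C \<in> ?Cs" and s: "s \<in> words k ({1..int n} - C)" using p ps by auto
    have sub: "C \<subseteq> {1..int n}" using C assms(1) by auto
    have finC: "finite C" and cardC: "card C = i" using fin[OF C] C by auto
    have len: "length (sorted_list_of_set C) = i" using cardC by simp
    have absC: "abs c = c" if "c \<in> C" for c using that sub by auto
    have "int (length s) = int n - int i"
      using length_words[OF s] card_Diff_subset[OF finC sub] cardC assms(3) by simp
    hence "drop_bounded k (sorted_list_of_set C @ s)"
      using C finC assms s len
      by (subst drop_bounded_append) (auto simp: words_def)
    moreover have "distinct (map abs (sorted_list_of_set C @ s))"
    proof -
      have m: "map abs (sorted_list_of_set C) = sorted_list_of_set C"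
        using finC absC by (intro map_idI) auto
      have "distinct (map abs s)" "abs ` set s = {1..int n} - C"
        using s by (auto simp: words_def)
      thus ?thesis using finC by (auto simp: m)
    qed
    moreover have "abs ` set (sorted_list_of_set C @ s) = {1..int n}"
    proof -
      have "abs ` C = C" using absC by force
      thus ?thesis using finC s sub by (auto simp: words_def image_Un)
    qed
    ultimately show "(case p of (C, s) \<Rightarrow> sorted_list_of_set C @ s)
        \<in> {r \<in> words k {1..int n}. sorted_wrt (<) (take i r)}"
      using len ps by (simp add: words_def)
    show "(set (take i (case p of (C, s) \<Rightarrow> sorted_list_of_set C @ s)),
           drop i (case p of (C, s) \<Rightarrow> sorted_list_of_set C @ s)) = p"
      using ps len finC by simp
    show "g (drop i (case p of (C, s) \<Rightarrow> sorted_list_of_set C @ s)) = (case p of (C, s) \<Rightarrow> g s)"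
      using ps len by simp
  next
    fix r assume "r \<in> {r \<in> words k {1..int n}. sorted_wrt (<) (take i r)}"
    hence r: "r \<in> words k {1..int n}" and so: "sorted_wrt (<) (take i r)" by auto
    have len: "length r = n" using length_words[OF r] by simp
    obtain a t where at: "r = a # t" using len assms by (cases r) auto
    have db: "drop_bounded k r" using r by (simp add: words_def)
    have rng: "\<bar>b\<bar> \<in> {1..int n}" if "b \<in> set r" for b using r that by (auto simp: words_def)
    have a: "0 < a" "int n - int k \<le> a"
      using db at len assms(1) rng[of a] by (auto simp: not_less)
    have ge: "a \<le> b" if "b \<in> set (take i r)" for b
      using so that at assms(2) by (cases i) auto
    have sub: "set (take i r) \<subseteq> {int n - int k..int n}"
      using ge a rng set_take_subset[of i r] by force
    have d: "distinct (map abs (take i r @ drop i r))" using r by (simp add: words_def)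
    have dt: "distinct (take i r)" using so by (simp add: strict_sorted_iff)
    have "abs ` set (take i r @ drop i r) = {1..int n}" using r by (simp add: words_def)
    moreover have "abs ` set (take i r) = set (take i r)" using ge a by force
    moreover have "abs ` set (take i r) \<inter> abs ` set (drop i r) = {}"
      using d by (simp only: map_append distinct_append set_map)
    ultimately have "abs ` set (drop i r) = {1..int n} - set (take i r)"
      by (auto simp only: set_append image_Un)
    moreover have "drop_bounded k (drop i r)"
      using db drop_bounded_appendD[of k "take i r" "drop i r"] by simp
    moreover have "distinct (map abs (drop i r))"
      using d by (simp only: map_append distinct_append)
    ultimately show "(set (take i r), drop i r) \<in> Sigma ?Cs (\<lambda>C. words k ({1..int n} - C))"
      using sub distinct_card[OF dt] len assms by (simp add: words_def)
    show "(case (set (take i r), drop i r) of (C, s) \<Rightarrow> sorted_list_of_set C @ s) = r"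
      using so sorted_list_of_set.idem_if_sorted_distinct[of "take i r"]
      by (simp add: strict_sorted_iff)
  qed
  finally show ?thesis ..
qed

section \<open>Standardization and the recurrence for words\<close>

lemma rdes_map:
  assumes "strict_mono_on (insert 0 (set r)) g" "g 0 = 0"
  shows "rdes (map g r) = rdes r"
  using assms(1)
proof (induction r)
  case (Cons a r)
  \<comment> \<open>0 is kept in the domain because \<open>rdes\<close> compares the last letter
    with 0.\<close>
  have less: "g u < g v \<longleftrightarrow> u < v" if "u \<in> insert 0 (set (a # r))" "v \<in> insert 0 (set (a # r))"
    for u v using strict_mono_on_less[OF Cons.prems that] .
  have "strict_mono_on (insert 0 (set r)) g"
    using Cons.prems by (rule monotone_on_subset) auto
  with Cons.IH less[of a 0] less[of a "hd r"] assms(2) show ?case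
    by (auto split: list.splits)
qed simp

text \<open>Quantifying over every \<open>p\<close> up to the length, not just over the position of
  \<open>a\<close>, lets the second hypothesis pass to suffixes.\<close>

lemma drop_bounded_map:
  assumes "\<forall>a\<in>set r. (0 < g a \<longleftrightarrow> 0 < a) \<and> (g a < 0 \<longleftrightarrow> a < 0)"
    and "\<forall>a\<in>set r. \<forall>p\<le>int (length r). 0 < a \<longrightarrow> (p - g a \<le> int k \<longleftrightarrow> p - a \<le> int k)"
  shows "drop_bounded k (map g r) \<longleftrightarrow> drop_bounded k r"
  using assms by (induction r) auto

text \<open>The rank map on \<open>V\<close>, extended to an odd function, fixes every positive entry
  below \<open>m\<close>, and no entry that is at least \<open>m\<close> can violate the drop bound at a position up to
  \<open>m + k\<close>.\<close>
lemma words_poly_standardize: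
  assumes fin: "finite V" and V: "{1..<m} \<subseteq> V" "V \<subseteq> {0<..}" and cardV: "int (card V) \<le> m + int k"
  shows "words_poly k V x = words_poly k {1..int (card V)} x"
proof -
  define f where "f v = int (card {w \<in> V. w \<le> v})" for v :: int
  define g where "g a = sgn a * f \<bar>a\<bar>" for a :: int
  define U where "U = {a. a = 0 \<or> \<bar>a\<bar> \<in> V}"
  have "{w \<in> V. w \<le> 0} = {}" using V(2) by force
  hence f0: "f 0 = 0" unfolding f_def by (simp only: card.empty of_nat_0)
  have f_less: "f u < f v" if "u < v" "v \<in> V" for u v
  proof -
    have "{w \<in> V. w \<le> u} \<subset> {w \<in> V. w \<le> v}" using that by force
    thus ?thesis unfolding f_def using fin by (simp add: psubset_card_mono)
  qed
  have f_mono: "f u \<le> f v" if "u \<le> v" for u v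
    unfolding f_def using fin that by (auto intro!: card_mono)
  have f_pos: "0 < f v" if "v \<in> V" for v using f_less[of 0 v] f0 that V(2) by auto
  have f_low: "f v = v" if "0 \<le> v" "v < m" for v
  proof -
    have "{w \<in> V. w \<le> v} = {1..v}" using V that by force
    thus ?thesis using that by (simp add: f_def)
  qed
  have abs_g: "\<bar>g a\<bar> = f \<bar>a\<bar>" if "a \<in> U" for a
    using that f_pos[of "\<bar>a\<bar>"] by (auto simp: g_def U_def abs_mult f0)
  have g0: "g 0 = 0" by (simp add: g_def)
  have g_mono: "strict_mono_on U g"
  proof (rule strict_mono_onI)
    fix a b assume ab: "a \<in> U" "b \<in> U" "a < b"
    have pos: "0 < f \<bar>c\<bar>" if "c \<in> U" "c \<noteq> 0" for c using that f_pos by (auto simp: U_def)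
    consider "b \<le> 0" | "0 \<le> a" | "a < 0" "0 < b" by linarith
    thus "g a < g b"
    proof cases
      case 1
      thus ?thesis using ab f_less[of "-b" "-a"] f0 by (auto simp: g_def U_def sgn_if)
    next
      case 2
      thus ?thesis using ab f_less[of a b] f0 by (auto simp: g_def U_def sgn_if)
    next
      case 3
      thus ?thesis using pos[of a] pos[of b] ab by (simp add: g_def)
    qed
  qed
  have f_inj: "inj_on f V" by (metis f_less inj_onI linorder_neqE order_less_irrefl)
  have f_img: "f ` V = {1..int (card V)}"
  proof (rule card_subset_eq)
    have "f v \<le> int (card V)" for v
      unfolding f_def using fin by (auto intro: card_mono)
    thus "f ` V \<subseteq> {1..int (card V)}" using f_pos by force
    show "card (f ` V) = card {1..int (card V)}"
      unfolding card_image[OF f_inj] by simp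
  qed simp
  have g_img: "\<exists>a\<in>U. a \<noteq> 0 \<and> g a = b" if b: "\<bar>b\<bar> \<in> {1..int (card V)}" for b
  proof -
    obtain v where v: "v \<in> V" "\<bar>b\<bar> = f v"
      using b unfolding f_img[symmetric] by blast
    have "0 < v" using v V(2) by auto
    thus ?thesis using v b
      by (intro bexI[of _ "sgn b * v"]) (auto simp: g_def U_def sgn_mult abs_mult sgn_if split: if_splits)
  qed
  have U_words: "insert 0 (set r) \<subseteq> U" if "r \<in> words k V" for r
    using that by (auto simp: words_def U_def)
  have sgn_g: "0 < g a \<longleftrightarrow> 0 < a" "g a < 0 \<longleftrightarrow> a < 0" if "a \<in> U" for a
    using strict_mono_on_less[OF g_mono, of 0 a] strict_mono_on_less[OF g_mono, of a 0] that g0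
    by (auto simp: U_def)
  have drop_g: "drop_bounded k (map g r) \<longleftrightarrow> drop_bounded k r"
    if r: "set r \<subseteq> U" "length r = card V" for r
  proof (rule drop_bounded_map)
    show "\<forall>a\<in>set r. (0 < g a \<longleftrightarrow> 0 < a) \<and> (g a < 0 \<longleftrightarrow> a < 0)" using sgn_g r by blast
    have "p - f a \<le> int k \<longleftrightarrow> p - a \<le> int k" if "a \<in> V" "p \<le> int (length r)" "0 < a" for a p
    proof (cases "a < m")
      case False
      \<comment> \<open>Once \<open>a\<close> and \<open>f a\<close> are both at least
        \<open>m\<close>, both differences are at most \<open>card V - m\<close>, hence at most
        \<open>k\<close>. The rank fixes \<open>m - 1\<close> and increases strictly up to
        \<open>a\<close>; for \<open>m\<close> below 1, positivity of \<open>f a\<close>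
        suffices.\<close>
      have "m \<le> f a" if "1 \<le> m"
      proof -
        have "m - 1 = f (m - 1)" using that by (intro f_low[symmetric]) auto
        also have "\<dots> < f a" using False \<open>a \<in> V\<close> by (intro f_less) auto
        finally show ?thesis by simp
      qed
      moreover have "0 < f a" using \<open>a \<in> V\<close> by (rule f_pos)
      ultimately show ?thesis using False that r(2) cardV by linarith
    qed (use that f_low[of a] in auto)
    thus "\<forall>a\<in>set r. \<forall>p\<le>int (length r). 0 < a \<longrightarrow> (p - g a \<le> int k \<longleftrightarrow> p - a \<le> int k)"
      using r(1) by (auto simp: g_def U_def)
  qed
  have dist_g: "distinct (map abs (map g r)) \<longleftrightarrow> distinct (map abs r)"
    and img_g: "abs ` set (map g r) = f ` abs ` set r" if r: "set r \<subseteq> U" "abs ` set r \<subseteq> V" for r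
  proof -
    have "map abs (map g r) = map f (map abs r)" using abs_g r by auto
    thus "distinct (map abs (map g r)) \<longleftrightarrow> distinct (map abs r)"
      using inj_on_subset[OF f_inj r(2)] by (simp only: distinct_map[of f] set_map) simp
    show "abs ` set (map g r) = f ` abs ` set r"
      using abs_g r(1) by (force simp: image_image intro!: image_cong)
  qed
  have bij: "bij_betw (map g) (words k V) (words k {1..int (card V)})"
  proof (rule bij_betw_imageI)
    show "inj_on (map g) (words k V)"
    proof (rule inj_onI)
      fix r s assume rs: "r \<in> words k V" "s \<in> words k V" "map g r = map g s"
      have "inj_on g (set r \<union> set s)"
        using strict_mono_on_imp_inj_on[OF g_mono] by (rule inj_on_subset) (use U_words rs in blast)
      thus "r = s" using rs(3) by (rule map_inj_on[rotated])
    qed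
    show "map g ` words k V = words k {1..int (card V)}"
    proof safe
      fix r assume r: "r \<in> words k V"
      have "set r \<subseteq> U" "abs ` set r = V" using U_words[OF r] r by (auto simp: words_def)
      thus "map g r \<in> words k {1..int (card V)}"
        using dist_g[of r] img_g[of r] drop_g[of r] length_words[OF r] r f_img
        by (simp add: words_def del: map_map)
    next
      fix s assume s: "s \<in> words k {1..int (card V)}"
      hence "\<bar>b\<bar> \<in> {1..int (card V)}" if "b \<in> set s" for b
        using that unfolding words_def by blast
      hence "\<forall>b\<in>set s. \<exists>a. a \<in> U \<and> a \<noteq> 0 \<and> g a = b"
        using g_img by meson
      then obtain h where h: "\<And>b. b \<in> set s \<Longrightarrow> h b \<in> U \<and> h b \<noteq> 0 \<and> g (h b) = b" by metis
      define r where "r = map h s"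
      have sr: "s = map g r" using h by (auto simp: r_def intro!: map_idI[symmetric])
      have rU: "set r \<subseteq> U" "abs ` set r \<subseteq> V" using h by (auto simp: r_def U_def)
      \<comment> \<open>The chosen preimages are only known to lie in \<open>V\<close>; injectivity
        of the rank shows that they exhaust it.\<close>
      have "f ` abs ` set r = f ` V"
        using img_g[OF rU] s sr f_img by (simp add: words_def)
      hence "abs ` set r = V" using f_inj rU(2) by (simp add: inj_on_image_eq_iff)
      moreover have "length r = card V" using length_words[OF s] by (simp add: r_def)
      ultimately have "r \<in> words k V"
        using s sr dist_g[OF rU] drop_g[OF rU(1)] by (simp add: words_def)
      thus "s \<in> map g ` words k V" using sr by auto
    qed
  qed
  have "rdes (map g r) = rdes r" if "r \<in> words k V" for r
    using g0 monotone_on_subset[OF g_mono U_words[OF that]] by (intro rdes_map)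
  hence "words_poly k V x = (\<Sum>r\<in>words k V. x ^ rdes (map g r))"
    by (simp add: words_poly_def)
  also have "\<dots> = words_poly k {1..int (card V)} x"
    unfolding words_poly_def by (rule sum.reindex_bij_betw[OF bij])
  finally show ?thesis .
qed

text \<open>In the expansion by ascending prefixes, a prefix of length \<open>Suc i\<close> has
  \<open>Suc k choose Suc i\<close> possible sets, and after standardization each of them
  contributes the same polynomial.\<close>

lemma words_poly_rec:
  fixes x :: "'a :: comm_ring_1"
  assumes "k < n"
  shows "words_poly k {1..int n} x =
    (\<Sum>i=0..k. of_nat (Suc k choose Suc i) * (x - 1) ^ i * words_poly k {1..int (n - Suc i)} x)"
proof -
  let ?W = "words k {1..int n}"
  have len: "length r = n" if "r \<in> ?W" for r using length_words[OF that] by simp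
  have pos: "r \<noteq> [] \<and> 0 < hd r" if "r \<in> ?W" for r
  proof (cases r)
    case (Cons a t)
    have "drop_bounded k r" "abs ` set r = {1..int n}" using that by (auto simp: words_def)
    moreover from this(2) have "1 \<le> \<bar>a\<bar>" using Cons by (metis atLeastAtMost_iff imageI list.set_intros(1))
    moreover have "k \<le> length t" using len[OF that] Cons assms by simp
    ultimately show ?thesis using Cons by (cases "a = 0") (auto simp: not_less)
  qed (use len[OF that] assms in auto)
  have fin: "finite ?W" by (rule finite_words) simp
  have block: "(\<Sum>r\<in>{r \<in> ?W. sorted_wrt (<) (take (Suc i) r)}. x ^ rdes (drop (Suc i) r))
      = of_nat (Suc k choose Suc i) * words_poly k {1..int (n - Suc i)} x" if i: "i < n" for i
  proof -
    have "words_poly k ({1..int n} - C) x = words_poly k {1..int (n - Suc i)} x"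
      if C: "C \<subseteq> {int n - int k..int n}" "card C = Suc i" for C
    proof -
      have "C \<subseteq> {1..int n}" "finite C" using C assms finite_subset by (force, blast)
      hence card: "card ({1..int n} - C) = n - Suc i" using C by (simp add: card_Diff_subset)
      \<comment> \<open>\<open>C\<close> only removes letters from n - k upwards, so all smaller
        ones survive, and \<open>m + k\<close> is n.\<close>
      show ?thesis unfolding card[symmetric]
        by (rule words_poly_standardize[where m = "int n - int k"]) (use C card in auto)
    qed
    hence "(\<Sum>r\<in>{r \<in> ?W. sorted_wrt (<) (take (Suc i) r)}. x ^ rdes (drop (Suc i) r))
      = (\<Sum>C | C \<subseteq> {int n - int k..int n} \<and> card C = Suc i. words_poly k {1..int (n - Suc i)} x)"
      using i assms by (subst sum_words_sorted_prefix) (auto simp: words_poly_def)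
    also have "\<dots> = of_nat (Suc k choose Suc i) * words_poly k {1..int (n - Suc i)} x"
    proof -
      have "card {int n - int k..int n} = Suc k" by (simp add: nat_add_distrib)
      thus ?thesis by (simp add: n_subsets del: card_atLeastAtMost_int binomial_Suc_Suc)
    qed
    finally show ?thesis .
  qed
  have "words_poly k {1..int n} x = (\<Sum>r\<in>?W. \<Sum>i<n. if sorted_wrt (<) (take (Suc i) r)
           then (x - 1) ^ i * x ^ rdes (drop (Suc i) r) else 0)"
    unfolding words_poly_def using power_rdes_expand[of _ x] pos len by (intro sum.cong) auto
  also have "\<dots> = (\<Sum>i<n. \<Sum>r\<in>?W. if sorted_wrt (<) (take (Suc i) r)
           then (x - 1) ^ i * x ^ rdes (drop (Suc i) r) else 0)"
    by (rule sum.swap)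
  also have "\<dots> = (\<Sum>i<n. (x - 1) ^ i *
      (\<Sum>r\<in>{r \<in> ?W. sorted_wrt (<) (take (Suc i) r)}. x ^ rdes (drop (Suc i) r)))"
    unfolding sum.inter_filter[OF fin] sum_distrib_left by (intro sum.cong refl) simp
  also have "\<dots> = (\<Sum>i<n. of_nat (Suc k choose Suc i) * (x - 1) ^ i * words_poly k {1..int (n - Suc i)} x)"
    using block by (intro sum.cong) (auto simp: mult_ac)
  \<comment> \<open>For i > k the binomial coefficient is 0, and k < n puts every i up to k in
    range.\<close>
  also have "\<dots> = (\<Sum>i=0..k. of_nat (Suc k choose Suc i) * (x - 1) ^ i * words_poly k {1..int (n - Suc i)} x)"
    using assms by (intro sum.mono_neutral_right) (auto simp: binomial_eq_0)
  finally show ?thesis .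
qed

subsection \<open>Signed permutations as words\<close>

fun rword :: "(int \<Rightarrow> int) \<Rightarrow> nat \<Rightarrow> int list" where
  "rword \<pi> 0 = []"
| "rword \<pi> (Suc m) = \<pi> (1 + int m) # rword \<pi> m"

lemma length_rword [simp]: "length (rword \<pi> m) = m"
  by (induction m) auto

lemma atLeastAtMost_int_Suc: "{a..int (Suc m)} = (if a \<le> 1 + int m then insert (1 + int m) {a..int m} else {})"
  by auto

lemma set_rword: "set (rword \<pi> m) = \<pi> ` {1..int m}"
  by (induction m) (simp_all add: atLeastAtMost_int_Suc del: of_nat_Suc)

lemma rword_eq_iff: "rword \<pi> m = rword \<sigma> m \<longleftrightarrow> (\<forall>i\<in>{1..int m}. \<pi> i = \<sigma> i)"
  by (induction m) (simp_all add: atLeastAtMost_int_Suc del: of_nat_Suc)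

lemma ex_rword: "\<exists>\<pi>. rword \<pi> (length r) = r"
proof (induction r)
  case (Cons a r)
  then obtain \<pi> where \<pi>: "rword \<pi> (length r) = r" by blast
  have "rword (\<pi>(1 + int (length r) := a)) (length r) = rword \<pi> (length r)"
    by (simp add: rword_eq_iff)
  thus ?case using \<pi> by (intro exI[of _ "\<pi>(1 + int (length r) := a)"]) (simp del: fun_upd_apply add: fun_upd_same)
qed simp

lemma rdes_rword:
  assumes "\<pi> 0 = 0"
  shows "rdes (rword \<pi> m) = des_B m \<pi>"
proof (induction m)
  case (Suc m)
  \<comment> \<open>For \<open>m = 0\<close> the default 0 stands for the value at 0.\<close>
  have "(case rword \<pi> m of [] \<Rightarrow> 0 | b # _ \<Rightarrow> b) = \<pi> (int m)"
    using assms by (cases m) (auto simp: add.commute)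
  moreover define S where "S = {i \<in> {0..int m - 1}. \<pi> i > \<pi> (i + 1)}"
  have "{i \<in> {0..int (Suc m) - 1}. \<pi> i > \<pi> (i + 1)} =
     (if \<pi> (1 + int m) < \<pi> (int m) then insert (int m) S else S)"
    by (auto simp: S_def add.commute order_le_less)
  moreover have "int m \<notin> S" "finite S"
    by (auto simp: S_def intro: finite_subset[of _ "{0..int m - 1}"])
  ultimately show ?case
    using Suc.IH unfolding rword.simps rdes.simps des_B_def S_def[symmetric]
    by (simp add: add.commute del: of_nat_Suc)
qed (simp add: des_B_def)

lemma drop_bounded_rword:
  "drop_bounded k (rword \<pi> m) \<longleftrightarrow>
     (\<forall>i\<in>{1..int m}. (0 < \<pi> i \<longrightarrow> i - \<pi> i \<le> int k) \<and> (\<pi> i < 0 \<longrightarrow> i \<le> int k))"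
  by (induction m) (auto simp add: atLeastAtMost_int_Suc simp del: of_nat_Suc)

text \<open>Nonzero values put every position into one of the two families, so for n > 0 the outer
  maximum is over a nonempty set and can be bounded elementwise.\<close>

lemma maxdrop_B_le_iff:
  assumes "\<forall>i\<in>{1..int n}. \<pi> i \<noteq> 0"
  shows "maxdrop_B n \<pi> \<le> int k \<longleftrightarrow> drop_bounded k (rword \<pi> n)"
proof (cases "n = 0")
  case False
  let ?A = "{i - \<pi> i |i. i \<in> {1..int n} \<and> \<pi> i > 0}" and ?B = "{i. i \<in> {1..int n} \<and> \<pi> i < 0}"
  have fin: "finite ?A" "finite ?B" by (auto simp: setcompr_eq_image simp del: atLeastAtMost_iff)
  have ne: "?A \<noteq> {} \<or> ?B \<noteq> {}"
  proof -
    have 1: "1 \<in> {1..int n}" using False by simp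
    with assms have "0 < \<pi> 1 \<or> \<pi> 1 < 0" by fastforce
    hence "1 - \<pi> 1 \<in> ?A \<or> 1 \<in> ?B" using 1 by blast
    thus ?thesis by (metis empty_iff)
  qed
  have Max_Max: "Max (Max ` ({A, B} - {{}})) \<le> c \<longleftrightarrow> (\<forall>y\<in>A \<union> B. y \<le> c)"
    if "finite A" "finite B" "A \<noteq> {} \<or> B \<noteq> {}" for A B :: "int set" and c
  proof -
    have "Max (Max ` ({A, B} - {{}})) \<le> c \<longleftrightarrow> (\<forall>S\<in>{A, B} - {{}}. Max S \<le> c)"
      using that(3) by (subst Max_le_iff) auto
    also have "\<dots> \<longleftrightarrow> (A \<noteq> {} \<longrightarrow> Max A \<le> c) \<and> (B \<noteq> {} \<longrightarrow> Max B \<le> c)"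
      by blast
    also have "\<dots> \<longleftrightarrow> (\<forall>y\<in>A \<union> B. y \<le> c)"
      using that(1,2) by (cases "A = {}"; cases "B = {}") auto
    finally show ?thesis .
  qed
  have "maxdrop_B n \<pi> \<le> int k \<longleftrightarrow> (\<forall>y\<in>?A \<union> ?B. y \<le> int k)"
    unfolding maxdrop_B_def if_not_P[OF False] by (rule Max_Max[OF fin ne])
  also have "\<dots> \<longleftrightarrow> drop_bounded k (rword \<pi> n)"
    unfolding drop_bounded_rword by blast
  finally show ?thesis .
qed (simp add: maxdrop_B_def)

lemma signed_permsD:
  assumes "\<pi> \<in> signed_perms n"
  shows "inj \<pi>" "\<pi> 0 = 0" "\<And>i. \<pi> (- i) = - \<pi> i" "\<pi> ` {- int n..int n} = {- int n..int n}"
    "\<And>i. i \<notin> {- int n..int n} \<Longrightarrow> \<pi> i = i"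
proof -
  have p: "\<pi> permutes {- int n..int n}" using assms by (simp add: signed_perms_def)
  show "inj \<pi>" "\<pi> ` {- int n..int n} = {- int n..int n}"
    using p permutes_inj permutes_image by blast+
  show out: "\<pi> i = i" if "i \<notin> {- int n..int n}" for i
    using permutes_not_in[OF p that] .
  \<comment> \<open>Outside [-n,n] the permutation is the identity, which is odd as well.\<close>
  show neg: "\<pi> (- i) = - \<pi> i" for i
    using assms out[of i] out[of "- i"] by (cases "i \<in> {- int n..int n}") (auto simp: signed_perms_def)
  show "\<pi> 0 = 0" using neg[of 0] by simp
qed

text \<open>Oddness determines a signed permutation from its values on [n], and conversely a word
  extends to an odd function.\<close>

lemma bij_betw_rword:
  "bij_betw (\<lambda>\<pi>. rword \<pi> n) (maxdrop_perms n k) (words k {1..int n})"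
proof (rule bij_betw_imageI)
  show "inj_on (\<lambda>\<pi>. rword \<pi> n) (maxdrop_perms n k)"
  proof (rule inj_onI, rule ext)
    fix \<pi> \<sigma> i
    assume "\<pi> \<in> maxdrop_perms n k" "\<sigma> \<in> maxdrop_perms n k" and eq: "rword \<pi> n = rword \<sigma> n"
    hence s: "\<pi> \<in> signed_perms n" "\<sigma> \<in> signed_perms n" by (auto simp: maxdrop_perms_def)
    consider "i \<in> {1..int n}" | "- i \<in> {1..int n}" | "i = 0" | "i \<notin> {- int n..int n}" by fastforce
    thus "\<pi> i = \<sigma> i"
    proof cases
      case 2
      hence "\<pi> (- i) = \<sigma> (- i)" using eq by (simp add: rword_eq_iff)
      thus ?thesis using signed_permsD(3)[OF s(1), of i] signed_permsD(3)[OF s(2), of i] by simp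
    qed (use eq signed_permsD[OF s(1)] signed_permsD[OF s(2)] in \<open>auto simp: rword_eq_iff\<close>)
  qed
  show "(\<lambda>\<pi>. rword \<pi> n) ` maxdrop_perms n k = words k {1..int n}"
  proof safe
    fix \<pi> assume "\<pi> \<in> maxdrop_perms n k"
    hence s: "\<pi> \<in> signed_perms n" and md: "maxdrop_B n \<pi> \<le> int k" by (auto simp: maxdrop_perms_def)
    note sD = signed_permsD[OF s]
    have nz: "\<pi> i \<noteq> 0" if "i \<in> {1..int n}" for i
      using injD[OF sD(1), of i 0] sD(2) that by auto
    have inj: "inj_on (\<lambda>i. \<bar>\<pi> i\<bar>) {1..int n}"
    proof (rule inj_onI)
      fix i j assume ij: "i \<in> {1..int n}" "j \<in> {1..int n}" "\<bar>\<pi> i\<bar> = \<bar>\<pi> j\<bar>"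
      \<comment> \<open>Injectivity gives i = j or i = -j, and both are positive.\<close>
      hence "\<pi> i = \<pi> j \<or> \<pi> i = \<pi> (- j)" using sD(3)[of j] by linarith
      thus "i = j" using injD[OF sD(1)] ij by fastforce
    qed
    have "(\<lambda>i. \<bar>\<pi> i\<bar>) ` {1..int n} \<subseteq> {1..int n}"
    proof safe
      fix i assume i: "i \<in> {1..int n}"
      hence "\<pi> i \<in> {- int n..int n}" using sD(4) by force
      thus "\<bar>\<pi> i\<bar> \<in> {1..int n}" using nz[OF i] by auto
    qed
    hence img: "(\<lambda>i. \<bar>\<pi> i\<bar>) ` {1..int n} = {1..int n}"
      using inj by (intro endo_inj_surj) auto
    have set: "abs ` set (rword \<pi> n) = {1..int n}" using img by (simp add: set_rword image_image)
    moreover have "distinct (map abs (rword \<pi> n))" using set by (intro card_distinct) simp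
    moreover have "drop_bounded k (rword \<pi> n)" using md nz by (simp add: maxdrop_B_le_iff)
    ultimately show "rword \<pi> n \<in> words k {1..int n}" by (simp add: words_def)
  next
    fix r assume r: "r \<in> words k {1..int n}"
    have len: "length r = n" using length_words[OF r] by simp
    obtain g where g: "rword g n = r" using ex_rword[of r] len by auto
    \<comment> \<open>\<open>sgn 0 = 0\<close> makes the odd extension vanish at 0.\<close>
    define \<pi> where "\<pi> i = (if i \<in> {- int n..int n} then sgn i * g \<bar>i\<bar> else i)" for i
    have \<pi>r: "rword \<pi> n = r" unfolding g[symmetric] by (simp add: rword_eq_iff \<pi>_def)
    have img: "(\<lambda>i. \<bar>g i\<bar>) ` {1..int n} = {1..int n}"
      using r by (simp add: words_def g[symmetric] set_rword image_image)
    hence inj: "inj_on (\<lambda>i. \<bar>g i\<bar>) {1..int n}" by (intro eq_card_imp_inj_on) auto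
    have rng: "\<bar>g i\<bar> \<in> {1..int n}" if "i \<in> {1..int n}" for i using img that by auto
    have abs_\<pi>: "\<bar>\<pi> i\<bar> = \<bar>g \<bar>i\<bar>\<bar>" if "i \<in> {- int n..int n}" "i \<noteq> 0" for i
      using that by (simp add: \<pi>_def abs_mult)
    have inj_\<pi>: "inj_on \<pi> {- int n..int n}"
    proof (rule inj_onI)
      fix i j assume ij: "i \<in> {- int n..int n}" "j \<in> {- int n..int n}" "\<pi> i = \<pi> j"
      have z: "\<pi> l = 0 \<longleftrightarrow> l = 0" if "l \<in> {- int n..int n}" for l
      proof (cases "l = 0")
        case False
        hence "\<bar>l\<bar> \<in> {1..int n}" using that by auto
        from rng[OF this] abs_\<pi>[OF that False] False show ?thesis by auto
      qed (simp add: \<pi>_def)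
      show "i = j"
      proof (cases "i = 0 \<or> j = 0")
        case False
        have ij1: "\<bar>i\<bar> \<in> {1..int n}" "\<bar>j\<bar> \<in> {1..int n}" using False ij by auto
        have "\<bar>g \<bar>i\<bar>\<bar> = \<bar>g \<bar>j\<bar>\<bar>" using abs_\<pi>[of i] abs_\<pi>[of j] ij False by auto
        hence e: "\<bar>i\<bar> = \<bar>j\<bar>" using inj ij1 by (auto dest: inj_onD)
        have "g \<bar>i\<bar> \<noteq> 0" using rng[OF ij1(1)] by auto
        hence "sgn i = sgn j" using ij e by (simp add: \<pi>_def)
        thus ?thesis using e by (simp add: sgn_if abs_if split: if_splits)
      qed (use z[of i] z[of j] ij in auto)
    qed
    have "\<pi> ` {- int n..int n} \<subseteq> {- int n..int n}"
    proof safe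
      fix i assume i: "i \<in> {- int n..int n}"
      show "\<pi> i \<in> {- int n..int n}"
      proof (cases "i = 0")
        case False
        hence "\<bar>i\<bar> \<in> {1..int n}" using i by auto
        hence "\<bar>\<pi> i\<bar> \<le> int n" using abs_\<pi>[OF i False] rng by auto
        thus ?thesis by auto
      qed (simp add: \<pi>_def)
    qed
    hence "bij_betw \<pi> {- int n..int n} {- int n..int n}"
      using inj_\<pi> by (simp add: bij_betw_def endo_inj_surj)
    moreover have "\<pi> i = i" if "i \<notin> {- int n..int n}" for i
      using that unfolding \<pi>_def by (rule if_not_P)
    ultimately have "\<pi> permutes {- int n..int n}" by (rule bij_imp_permutes)
    moreover have "\<pi> (- i) = - \<pi> i" for i by (auto simp: \<pi>_def)
    ultimately have s: "\<pi> \<in> signed_perms n" by (simp add: signed_perms_def)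
    have "\<pi> i \<noteq> 0" if "i \<in> {1..int n}" for i
      using abs_\<pi>[of i] rng[OF that] that by auto
    hence "maxdrop_B n \<pi> \<le> int k" using r \<pi>r by (simp add: maxdrop_B_le_iff words_def)
    with s have "\<pi> \<in> maxdrop_perms n k" by (simp add: maxdrop_perms_def)
    thus "r \<in> (\<lambda>\<pi>. rword \<pi> n) ` maxdrop_perms n k" using \<pi>r by blast
  qed
qed

lemma poly_maxdrop_poly:
  fixes x :: "'a :: comm_ring_1"
  shows "poly (map_poly of_int (maxdrop_poly n k)) x = words_poly k {1..int n} x"
proof -
  have "map_poly of_int (maxdrop_poly n k) = (\<Sum>\<pi>\<in>maxdrop_perms n k. monom (1 :: 'a) (des_B n \<pi>))"
    by (rule poly_eqI) (simp add: maxdrop_poly_def coeff_map_poly coeff_sum if_distrib cong: if_cong)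
  hence "poly (map_poly of_int (maxdrop_poly n k)) x = (\<Sum>\<pi>\<in>maxdrop_perms n k. x ^ des_B n \<pi>)"
    by (simp add: poly_sum poly_monom)
  also have "\<dots> = (\<Sum>\<pi>\<in>maxdrop_perms n k. x ^ rdes (rword \<pi> n))"
    by (intro sum.cong) (auto simp: rdes_rword signed_permsD maxdrop_perms_def)
  also have "\<dots> = words_poly k {1..int n} x"
    unfolding words_poly_def by (rule sum.reindex_bij_betw[OF bij_betw_rword])
  finally show ?thesis .
qed

text \<open>A positive value drops by less than its position, and all positions are at most n, so
  the bound is automatic.\<close>

lemma maxdrop_poly_eq_eulerian_B:
  assumes "n \<le> k"
  shows "maxdrop_poly n k = eulerian_B n"
proof -
  have "maxdrop_B n \<pi> \<le> int k" if "\<pi> \<in> signed_perms n" for \<pi>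
  proof -
    have "\<forall>i\<in>{1..int n}. \<pi> i \<noteq> 0"
      using signed_permsD(1,2)[OF that] by (metis atLeastAtMost_iff injD not_one_le_zero)
    moreover have "drop_bounded k (rword \<pi> n)"
      using assms by (auto simp: drop_bounded_rword)
    ultimately show ?thesis by (simp add: maxdrop_B_le_iff)
  qed
  hence "maxdrop_perms n k = signed_perms n" by (auto simp: maxdrop_perms_def)
  thus ?thesis by (simp add: maxdrop_poly_def eulerian_B_def)
qed

subsection \<open>Extracting the exponents divisible by K\<close>

text \<open>Series are compared modulo this property. Since \<open>d\<close> runs over all integers,
  multiplication by u^K permutes the tested exponents.\<close>

definition vanishes_at_multiples :: "nat \<Rightarrow> 'a :: comm_ring_1 fls \<Rightarrow> bool" where
  "vanishes_at_multiples K f \<longleftrightarrow> (\<forall>d. fls_nth f (int K * d) = 0)"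

lemma vanishes_at_multiples_diff:
  "vanishes_at_multiples K f \<Longrightarrow> vanishes_at_multiples K g \<Longrightarrow> vanishes_at_multiples K (f - g)"
  by (simp add: vanishes_at_multiples_def)

lemma vanishes_at_multiples_sum:
  "(\<And>i. i \<in> A \<Longrightarrow> vanishes_at_multiples K (f i)) \<Longrightarrow> vanishes_at_multiples K (\<Sum>i\<in>A. f i)"
  by (simp add: vanishes_at_multiples_def fls_nth_sum)

lemma vanishes_at_multiples_mult_of_nat:
  assumes "vanishes_at_multiples K f"
  shows "vanishes_at_multiples K (of_nat c * f)"
  using vanishes_at_multiples_sum[of "{..<c}" K "\<lambda>_. f"] assms by simp

lemma vanishes_at_multiples_mult_X_power:
  assumes "vanishes_at_multiples K f"
  shows "vanishes_at_multiples K (fls_X ^ K * f)"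
proof -
  have "fls_nth (fls_X ^ K * f) (int K * d) = fls_nth f (int K * (d - 1))" for d
    by (simp add: fls_X_power_times_conv_shift algebra_simps)
  thus ?thesis using assms by (simp add: vanishes_at_multiples_def)
qed

lemma vanishes_at_multiples_mult_X_power_power:
  assumes "vanishes_at_multiples K f"
  shows "vanishes_at_multiples K ((fls_X ^ K) ^ j * f)"
  using assms by (induction j) (simp_all add: vanishes_at_multiples_mult_X_power mult.assoc)

lemma vanishes_at_multiples_mult_X_power_minus_1_power:
  assumes "vanishes_at_multiples K f"
  shows "vanishes_at_multiples K ((fls_X ^ K - 1) ^ j * f)"
proof (induction j)
  case (Suc j)
  have "(fls_X ^ K - 1) ^ Suc j * f =
      fls_X ^ K * ((fls_X ^ K - 1) ^ j * f) - (fls_X ^ K - 1) ^ j * f"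
    by (simp add: algebra_simps)
  thus ?case using Suc
    by (simp only: vanishes_at_multiples_diff vanishes_at_multiples_mult_X_power)
qed (use assms in simp)

lemma vanishes_at_multiples_mult_words_poly:
  assumes "vanishes_at_multiples K f"
  shows "vanishes_at_multiples K (words_poly k V (fls_X ^ K) * f)"
  unfolding words_poly_def sum_distrib_right
  by (intro vanishes_at_multiples_sum vanishes_at_multiples_mult_X_power_power assms)

text \<open>The hypothesis makes the coefficients of \<open>f\<close> constant along the multiples
  of \<open>K\<close>, and a Laurent series has none far enough to the left.\<close>

lemma vanishes_at_multiples_cancel_1_minus_X_power:
  assumes "0 < K" "vanishes_at_multiples K ((1 - fls_X ^ K) * f)"
  shows "vanishes_at_multiples K f"
proof -
  have step: "fls_nth f (int K * d) = fls_nth f (int K * (d - 1))" for d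
  proof -
    have "fls_nth ((1 - fls_X ^ K) * f) (int K * d) = 0"
      using assms(2) by (simp add: vanishes_at_multiples_def)
    thus ?thesis by (simp add: fls_X_power_times_conv_shift algebra_simps)
  qed
  have shift: "fls_nth f (int K * d) = fls_nth f (int K * (d - int m))" for d m
  proof (induction m)
    case (Suc m)
    thus ?case using step[of "d - int m"] by (simp add: algebra_simps)
  qed simp
  have "fls_nth f (int K * d) = 0" for d
  proof -
    \<comment> \<open>This puts \<open>d - m\<close> below both 0 and the subdegree; being negative,
      it only decreases when multiplied by \<open>K\<close>.\<close>
    define m where "m = nat (\<bar>d\<bar> + \<bar>fls_subdegree f\<bar> + 1)"
    have neg: "d - int m < 0" "d - int m < fls_subdegree f" by (auto simp: m_def)
    have "int K * (d - int m) \<le> 1 * (d - int m)"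
      by (rule mult_right_mono_neg) (use assms(1) neg(1) in simp_all)
    also have "\<dots> < fls_subdegree f" using neg(2) by simp
    finally show ?thesis unfolding shift[of d m] by (rule fls_eq0_below_subdegree)
  qed
  thus ?thesis by (simp add: vanishes_at_multiples_def)
qed

lemma vanishes_at_multiples_cancel_1_minus_X_power_power:
  assumes "0 < K" "vanishes_at_multiples K ((1 - fls_X ^ K) ^ j * f)"
  shows "vanishes_at_multiples K f"
  using assms(2)
proof (induction j)
  case (Suc j)
  have "vanishes_at_multiples K ((1 - fls_X ^ K) * ((1 - fls_X ^ K) ^ j * f))"
    using Suc.prems by (simp add: mult.assoc)
  thus ?case by (rule Suc.IH[OF vanishes_at_multiples_cancel_1_minus_X_power[OF assms(1)]])
qed simp

section \<open>Binomial inversion\<close>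

lemma choose_mult_alternating_sum:
  "(\<Sum>r\<le>m. (-1) ^ r * of_nat (m choose r) * of_nat (r choose j) :: 'a :: comm_ring_1)
     = (if j = m then (-1) ^ m else 0)"
proof (cases "j \<le> m")
  case True
  have "(\<Sum>r\<le>m. (-1) ^ r * of_nat (m choose r) * of_nat (r choose j) :: 'a)
      = (\<Sum>r=j..m. (-1) ^ r * of_nat (m choose r) * of_nat (r choose j))"
    by (intro sum.mono_neutral_right) (auto simp: binomial_eq_0)
  also have "\<dots> = (\<Sum>s\<le>m - j. (-1) ^ j * of_nat (m choose j) * ((-1) ^ s * of_nat ((m - j) choose s)))"
  proof (rule sum.reindex_bij_witness[where i = "\<lambda>s. s + j" and j = "\<lambda>r. r - j"])
    fix r assume r: "r \<in> {j..m}"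
    have s1: "(-1) ^ r = (-1) ^ j * ((-1) ^ (r - j) :: 'a)" using r by (simp flip: power_add)
    \<comment> \<open>This identity reduces the sum to the alternating sum of row
      \<open>m - j\<close>, which vanishes unless \<open>j = m\<close>.\<close>
    have s2: "of_nat (m choose r) * of_nat (r choose j)
        = of_nat (m choose j) * (of_nat ((m - j) choose (r - j)) :: 'a)"
      using choose_mult[of j r m] r by (simp flip: of_nat_mult)
    show "(-1) ^ j * of_nat (m choose j) * ((-1) ^ (r - j) * of_nat ((m - j) choose (r - j)))
        = ((-1) ^ r * of_nat (m choose r) * of_nat (r choose j) :: 'a)"
      unfolding mult.assoc s1 s2 by (simp only: mult.left_commute)
  qed (use True in auto)
  also have "\<dots> = (if j = m then (-1) ^ m else 0)"
    using choose_alternating_sum[of "m - j", where 'a = 'a] True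
    by (simp flip: sum_distrib_left)
  finally show ?thesis .
qed (auto simp: binomial_eq_0 intro!: sum.neutral)

text \<open>Multiplied out, the product has only exponents r - i of absolute value at most k, so 0
  is the only multiple of k + 1 among them. Its coefficient is the alternating sum above.\<close>

lemma vanishes_at_multiples_binomial_sum:
  fixes j k m :: nat
  assumes "j \<le> k" "m \<le> k"
  shows "vanishes_at_multiples (k + 1)
     ((\<Sum>i=j..k. of_nat (i choose j) * fls_X powi (- int i)) * (1 - fls_X) ^ m
        - (if j = m then (-1) ^ m else 0) :: 'a :: field fls)"
proof -
  have pw: "(1 - fls_X) ^ m = (\<Sum>r\<le>m. (-1) ^ r * of_nat (m choose r) * (fls_X :: 'a fls) ^ r)"
    using binomial_ring[of "- fls_X" "1 :: 'a fls" m]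
    by (simp add: power_minus[of fls_X] mult_ac)
  have pm: "(fls_X :: 'a fls) powi (int r - int i) = fls_X ^ r * fls_X powi (- int i)" for r i
    using power_int_add[of "fls_X :: 'a fls" "int r" "- int i"] by simp
  have eq: "(\<Sum>i=j..k. of_nat (i choose j) * fls_X powi (- int i)) * (1 - fls_X) ^ m
      = (\<Sum>i=j..k. \<Sum>r\<le>m. of_int ((-1) ^ r * int (m choose r) * int (i choose j)) *
           (fls_X :: 'a fls) powi (int r - int i))"
    unfolding pw sum_product by (intro sum.cong refl) (simp only: pm mult_ac of_int_mult of_int_power of_int_minus of_int_1 of_int_of_nat_eq)
  have coeff: "fls_nth (of_int c * fls_X powi l) e = (if l = e then of_int c else (0 :: 'a))" for c l e
    by (simp add: fls_of_int)
  have nth: "fls_nth ((\<Sum>i=j..k. of_nat (i choose j) * fls_X powi (- int i)) * (1 - fls_X) ^ m) e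
      = (\<Sum>i=j..k. \<Sum>r\<le>m. if int r - int i = e
           then (-1) ^ r * of_nat (m choose r) * (of_nat (i choose j) :: 'a) else 0)" for e
    unfolding eq fls_nth_sum coeff by (intro sum.cong refl) simp
  have const: "fls_nth (if j = m then (-1) ^ m else 0 :: 'a fls) e = (if j = m \<and> e = 0 then (-1) ^ m else 0)"
    for e by (cases "even m") auto
  have "fls_nth ((\<Sum>i=j..k. of_nat (i choose j) * fls_X powi (- int i)) * (1 - fls_X) ^ m) (int (k + 1) * d)
      = (if j = m \<and> d = 0 then (-1) ^ m else (0 :: 'a))" for d
  proof (cases "d = 0")
    case True
    have "(\<Sum>i=j..k. \<Sum>r\<le>m. if int r - int i = 0
           then (-1) ^ r * of_nat (m choose r) * (of_nat (i choose j) :: 'a) else 0)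
       = (\<Sum>r\<le>m. \<Sum>i=j..k. if i = r
           then (-1) ^ r * of_nat (m choose r) * (of_nat (r choose j) :: 'a) else 0)"
      by (subst sum.swap) (auto intro!: sum.cong)
    \<comment> \<open>The index r < j missing from the inner range has
      \<open>r choose j = 0\<close>.\<close>
    also have "\<dots> = (\<Sum>r\<le>m. (-1) ^ r * of_nat (m choose r) * of_nat (r choose j))"
      using assms(2) by (intro sum.cong) (auto simp: binomial_eq_0)
    finally show ?thesis unfolding nth choose_mult_alternating_sum using True by simp
  next
    case False
    have "int r - int i \<noteq> int (k + 1) * d" if "i \<le> k" "r \<le> m" for i r
    proof
      assume "int r - int i = int (k + 1) * d"
      hence "int (k + 1) * \<bar>d\<bar> = \<bar>int r - int i\<bar>" by (simp add: abs_mult)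
      also have "\<dots> < int (k + 1)" using that assms(2) by linarith
      finally have "int (k + 1) * \<bar>d\<bar> < int (k + 1) * 1" by simp
      hence "\<bar>d\<bar> < 1" by (rule mult_left_less_imp_less) simp
      thus False using False by simp
    qed
    thus ?thesis using False unfolding nth by (auto intro!: sum.neutral)
  qed
  thus ?thesis by (auto simp: vanishes_at_multiples_def const simp del: of_nat_Suc of_nat_add)
qed

lemma fls_nth_poly_X_power:
  assumes "0 < K"
  shows "fls_nth (poly (map_poly of_int p) (fls_X ^ K :: 'a :: comm_ring_1 fls)) (int K * d)
       = (if d < 0 then 0 else of_int (coeff p (nat d)))"
proof (induction p arbitrary: d)
  case (pCons a p)
  have "fls_nth (fls_X ^ K * f) (int K * d) = fls_nth f (int K * (d - 1))" for f :: "'a fls"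
    by (simp add: fls_X_power_times_conv_shift algebra_simps)
  hence shift: "fls_nth (poly (map_poly of_int (pCons a p)) (fls_X ^ K :: 'a fls)) (int K * d)
      = (if d = 0 then of_int a else 0) + (if d < 1 then 0 else of_int (coeff p (nat (d - 1))))"
    using assms pCons.IH[of "d - 1"] by (simp add: map_poly_pCons fls_of_int_nth)
  show ?case
  proof (cases "0 < d")
    case True
    hence "nat d = Suc (nat (d - 1))" by simp
    thus ?thesis unfolding shift using True by (simp only: coeff_pCons_Suc) simp
  qed (auto simp: shift)
qed simp

section \<open>Comparing the series with the word polynomials\<close>

theorem theorem1p7:
  fixes n k :: nat
  shows "fps_of_poly (map_poly rat_of_int (maxdrop_poly n k))
       = Abs_fps (\<lambda>d. gamma_coeff n k (int ((k + 1) * d)))"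
proof -
  define x where "x = (fls_X :: rat fls) ^ (k + 1)"
  \<comment> \<open>\<open>v\<close> is 1/w for the w of the overview, so lowering the index of
    \<open>h\<close> by one multiplies by \<open>v\<close>.\<close>
  define v where "v = (1 - fls_X) / (1 - x)"
  define W where "W m = words_poly k {1..int m} x" for m
  define h where "h m = Q_series k * inverse v powi (int m - int k)" for m
  let ?Z = "vanishes_at_multiples (k + 1)"
  have X1: "(fls_X :: rat fls) \<noteq> 1"
    by (metis fls_X_nth fls_one_nth one_neq_zero zero_neq_one)
  have x1: "x \<noteq> 1"
  proof
    assume "x = 1"
    hence "fls_nth x 0 = 1" by simp
    thus False by (simp add: x_def del: power_Suc)
  qed
  have v0: "v \<noteq> 0" using X1 x1 by (simp add: v_def)
  have xv: "(x - 1) * v = fls_X - 1" using x1 by (simp add: v_def field_simps)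
  \<comment> \<open>By \<open>xv\<close>, 1 + (x-1)v is u, whose power k + 1 is x. Expanding that
    power, removing the term 1 and dividing by x - 1 gives the claim.\<close>
  have binom: "(\<Sum>i=0..k. of_nat (Suc k choose Suc i) * (x - 1) ^ i * v ^ Suc i) = 1"
  proof -
    have "1 + (x - 1) * (\<Sum>i=0..k. of_nat (Suc k choose Suc i) * (x - 1) ^ i * v ^ Suc i)
      = 1 + (\<Sum>i=0..k. of_nat (Suc k choose Suc i) * ((x - 1) * v) ^ Suc i)"
      by (simp add: sum_distrib_left power_mult_distrib mult_ac del: binomial_Suc_Suc)
    also have "\<dots> = (\<Sum>i\<le>Suc k. of_nat (Suc k choose i) * ((x - 1) * v) ^ i)"
      by (simp add: sum.atMost_Suc_shift atLeast0AtMost del: binomial_Suc_Suc sum.atMost_Suc)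
    also have "\<dots> = ((x - 1) * v + 1) ^ Suc k"
      by (simp add: binomial_ring del: binomial_Suc_Suc power_Suc sum.atMost_Suc)
    also have "\<dots> = x" unfolding xv by (simp add: x_def)
    finally have "1 + (x - 1) * (\<Sum>i=0..k. of_nat (Suc k choose Suc i) * (x - 1) ^ i * v ^ Suc i) = x" .
    moreover have "s = 1" if "1 + (x - 1) * s = x" for s
    proof -
      have "(x - 1) * s = (x - 1) * 1" using that by (simp add: algebra_simps)
      thus ?thesis using x1 by simp
    qed
    ultimately show ?thesis by blast
  qed
  have h_rec: "h m = (\<Sum>i=0..k. of_nat (Suc k choose Suc i) * (x - 1) ^ i * h (m - Suc i))"
    if "k < m" for m
  proof -
    have "h (m - Suc i) = h m * v ^ Suc i" if "i \<le> k" for i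
    proof -
      have "int (m - Suc i) - int k = (int m - int k) - int (Suc i)"
        using that \<open>k < m\<close> by simp
      moreover have "inverse v powi (a - int c) = inverse v powi a * v ^ c" for a c
        using v0 by (simp add: power_int_diff power_inverse divide_inverse)
      ultimately show ?thesis by (simp only: h_def mult.assoc)
    qed
    hence "(\<Sum>i=0..k. of_nat (Suc k choose Suc i) * (x - 1) ^ i * h (m - Suc i))
      = (\<Sum>i=0..k. h m * (of_nat (Suc k choose Suc i) * (x - 1) ^ i * v ^ Suc i))"
      by (intro sum.cong) (auto simp: mult_ac)
    also have "\<dots> = h m" by (simp only: binom mult_1_right flip: sum_distrib_left)
    finally show ?thesis ..
  qed
  have W_closed: "?Z (W m * f)" if "?Z f" for m f
    unfolding W_def x_def using that by (rule vanishes_at_multiples_mult_words_poly)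
  have x_closed: "?Z ((x - 1) ^ j * f)" if "?Z f" for j f
    unfolding x_def using that by (rule vanishes_at_multiples_mult_X_power_minus_1_power)
  \<comment> \<open>As k - j is at most k, the Eulerian polynomials in \<open>Q_series\<close> are
    themselves word polynomials for the same k.\<close>
  have eulerian_W: "poly (map_poly of_int (eulerian_B (k - j))) x = W (k - j)" for j
    unfolding W_def poly_maxdrop_poly[symmetric] by (simp add: maxdrop_poly_eq_eulerian_B)
  have Q: "Q_series k = (\<Sum>j=0..k. W (k - j) * ((x - 1) ^ j *
      (\<Sum>i=j..k. of_nat (i choose j) * fls_X powi (- int i))))"
    by (simp only: Q_series_def eulerian_W mult.assoc flip: x_def)
  have small: "?Z (h m - W m)" if "m \<le> k" for m
  proof -
    define t where "t = k - m"
    let ?s = "\<lambda>j. (\<Sum>i=j..k. of_nat (i choose j) * fls_X powi (- int i)) :: rat fls"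
    have tk: "t \<le> k" "m = k - t" using that by (auto simp: t_def)
    have "h m = Q_series k * v ^ t"
    proof -
      have "int m - int k = - int t" using that by (simp add: t_def)
      thus ?thesis by (simp add: h_def power_int_minus power_inverse)
    qed
    \<comment> \<open>The factor (1-x)^t clears the denominator of v^t and is cancelled again at the
      end.\<close>
    hence "(1 - x) ^ t * (h m - W m) = Q_series k * (1 - fls_X) ^ t - (1 - x) ^ t * W m"
      using x1 by (simp add: v_def power_divide algebra_simps)
    \<comment> \<open>Rewritten as a sum with the single nonzero term j = t, to be subtracted from
      the product with \<open>Q_series\<close> summand by summand.\<close>
    also have "(1 - x) ^ t * W m = (\<Sum>j=0..k. W (k - j) * ((x - 1) ^ j * (if j = t then (-1) ^ t else 0)))"
    proof -
      have "(1 - x) ^ t = (x - 1) ^ t * (-1) ^ t"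
        by (simp flip: power_mult_distrib)
      moreover have "(\<Sum>j=0..k. W (k - j) * ((x - 1) ^ j * (if j = t then (-1) ^ t else 0)))
         = (\<Sum>j=0..k. if j = t then W (k - t) * ((x - 1) ^ t * (-1) ^ t) else 0)"
        by (intro sum.cong) auto
      ultimately show ?thesis using tk by (simp add: mult_ac)
    qed
    also have "Q_series k * (1 - fls_X) ^ t - \<dots> =
      (\<Sum>j=0..k. W (k - j) * ((x - 1) ^ j * (?s j * (1 - fls_X) ^ t - (if j = t then (-1) ^ t else 0))))"
      unfolding Q
      by (subst sum_distrib_right, subst sum_subtractf[symmetric], intro sum.cong refl)
         (simp only: right_diff_distrib mult.assoc)
    also have "?Z \<dots>"
      using tk by (intro vanishes_at_multiples_sum W_closed x_closed vanishes_at_multiples_binomial_sum) auto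
    finally show ?thesis
      unfolding x_def by (rule vanishes_at_multiples_cancel_1_minus_X_power_power[rotated]) simp
  qed
  \<comment> \<open>Above k both sequences obey the same linear recurrence with coefficients
    polynomial in x, so their difference inherits the property from smaller indices.\<close>
  have main: "?Z (h m - W m)" for m
  proof (induction m rule: less_induct)
    case (less m)
    show ?case
    proof (cases "m \<le> k")
      case False
      have "W m = (\<Sum>i=0..k. of_nat (Suc k choose Suc i) * (x - 1) ^ i * W (m - Suc i))"
        unfolding W_def using False by (intro words_poly_rec) simp
      with h_rec[of m] False have "h m - W m = (\<Sum>i=0..k. of_nat (Suc k choose Suc i) *
          ((x - 1) ^ i * (h (m - Suc i) - W (m - Suc i))))"
        by (simp add: sum_subtractf right_diff_distrib mult.assoc del: binomial_Suc_Suc)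
      moreover have "?Z ((x - 1) ^ i * (h (m - Suc i) - W (m - Suc i)))" for i
        by (rule x_closed, rule less.IH) (use False in simp)
      ultimately show ?thesis
        by (simp only: vanishes_at_multiples_sum vanishes_at_multiples_mult_of_nat)
    qed (rule small)
  qed
  have "coeff (map_poly rat_of_int (maxdrop_poly n k)) d = gamma_coeff n k (int ((k + 1) * d))" for d
  proof -
    have "gamma_coeff n k (int ((k + 1) * d)) = fls_nth (h n) (int (k + 1) * int d)"
      by (simp add: gamma_coeff_def h_def v_def x_def algebra_simps)
    also have "\<dots> = fls_nth (W n) (int (k + 1) * int d)"
      using main[of n] by (simp add: vanishes_at_multiples_def)
    also have "\<dots> = coeff (map_poly rat_of_int (maxdrop_poly n k)) d"
    proof -
      have "fls_nth (W n) (int (k + 1) * int d) = of_int (coeff (maxdrop_poly n k) d)"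
        unfolding W_def x_def poly_maxdrop_poly[symmetric]
        using fls_nth_poly_X_power[of "k + 1" "maxdrop_poly n k" "int d", where 'a = rat] by simp
      thus ?thesis by (simp add: coeff_map_poly)
    qed
    finally show ?thesis ..
  qed
  thus ?thesis by (intro fps_ext) simp
qed

end
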